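(* Let $X$ be a Tychonoff space. The following are equivalent: (1) $B(X)$ satisfies $S_{1}(\mathcal{A},\mathcal{A})$; (2) $X$ satisfies $S_{1}(\mathcal{B},\mathcal{B})$; (3) $B(X)$ satisfies $S_{1}(\mathcal{B}_f,\mathcal{B}_f)$ for every $f\in B(X)$; (4) $B(X)$ satisfies $S_{1}(\mathcal{A},\mathcal{B}_f)$ for every $f\in B(X)$.
   Context: $B(X)$ is the set of all Baire functions on $X$, i.e. the smallest class of functions $X\to\mathbb{R}$ containing all continuous functions and closed under pointwise limits of sequences, with the topology of pointwise convergence. A Baire set of $X$ is a member of the $\sigma$-algebra generated by the zero-sets of continuous real-valued functions on $X$. $\mathcal{B}$ is the family of countable covers of $X$ by Baire sets; covers are nontrivial, i.e. $X$ is not a member of the cover. A set $A\subseteq B(X)$ is $1$-dense in $B(X)$ if for each $x\in X$ and each nonempty open $W\subseteq\mathbb{R}$ there is $g\in A$ with $g(x)\in W$. $\mathcal{A}$ is the family of countable $1$-dense subsets of $B(X)$. For $f\in B(X)$, a set $B\subseteq B(X)$ is $1$-dense at $f$ if for each $x\in X$ and $\epsilon>0$ there is $h\in B$ with $|h(x)-f(x)|<\epsilon$. $\mathcal{B}_f$ is the family of countable subsets of $B(X)$ that are $1$-dense at $f$. $S_1(\mathcal{P},\mathcal{Q})$: for each sequence $(A_n)_{n\in\omega}$ of elements of $\mathcal{P}$ there are $b_n\in A_n$ ($n\in\omega$) such that $\{b_n:n\in\omega\}\in\mathcal{Q}$. *)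

theory Defs
  imports "HOL-Analysis.Analysis"
begin

definition tychonoff_space :: "'a topology \<Rightarrow> bool" where
  "tychonoff_space X \<longleftrightarrow> completely_regular_space X \<and> Hausdorff_space X"

text \<open>A function on the space is represented by the unique HOL function that agrees with it on
  \<open>topspace X\<close> and is \<open>undefined\<close> elsewhere, so that distinct members of \<open>baire_functions X\<close>
  are distinct functions on the space.\<close>

inductive_set baire_functions :: "'a topology \<Rightarrow> ('a \<Rightarrow> real) set" for X :: "'a topology" where
  continuous:
    "f \<in> extensional (topspace X) \<Longrightarrow> continuous_map X euclideanreal f \<Longrightarrow> f \<in> baire_functions X"
| pointwise_limit:
    "(\<And>n::nat. g n \<in> baire_functions X) \<Longrightarrow> f \<in> extensional (topspace X) \<Longrightarrow>
     (\<And>x. x \<in> topspace X \<Longrightarrow> (\<lambda>n. g n x) \<longlonglongrightarrow> f x) \<Longrightarrow> f \<in> baire_functions X"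

definition zero_sets :: "'a topology \<Rightarrow> 'a set set" where
  "zero_sets X = {{x \<in> topspace X. g x = 0} | g. continuous_map X euclideanreal g}"

definition baire_sets :: "'a topology \<Rightarrow> 'a set set" where
  "baire_sets X = sigma_sets (topspace X) (zero_sets X)"

text \<open>Throughout, countable means finite or countably infinite.\<close>

definition countable_baire_covers :: "'a topology \<Rightarrow> 'a set set set" where
  "countable_baire_covers X =
    {\<U>. countable \<U> \<and> \<U> \<subseteq> baire_sets X \<and> \<Union>\<U> = topspace X \<and> topspace X \<notin> \<U>}"

definition one_dense :: "'a topology \<Rightarrow> ('a \<Rightarrow> real) set \<Rightarrow> bool" where
  "one_dense X A \<longleftrightarrow>
    (\<forall>x\<in>topspace X. \<forall>W. open W \<and> W \<noteq> {} \<longrightarrow> (\<exists>g\<in>A. g x \<in> W))"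

definition one_dense_at :: "'a topology \<Rightarrow> ('a \<Rightarrow> real) \<Rightarrow> ('a \<Rightarrow> real) set \<Rightarrow> bool" where
  "one_dense_at X f B \<longleftrightarrow>
    (\<forall>x\<in>topspace X. \<forall>\<epsilon>>0. \<exists>h\<in>B. \<bar>h x - f x\<bar> < \<epsilon>)"

definition one_dense_family :: "'a topology \<Rightarrow> ('a \<Rightarrow> real) set set" where
  "one_dense_family X = {A. countable A \<and> A \<subseteq> baire_functions X \<and> one_dense X A}"

definition one_dense_at_family :: "'a topology \<Rightarrow> ('a \<Rightarrow> real) \<Rightarrow> ('a \<Rightarrow> real) set set" where
  "one_dense_at_family X f = {B. countable B \<and> B \<subseteq> baire_functions X \<and> one_dense_at X f B}"

definition S1 :: "'b set set \<Rightarrow> 'b set set \<Rightarrow> bool" where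
  "S1 \<P> \<Q> \<longleftrightarrow>
    (\<forall>A :: nat \<Rightarrow> 'b set. (\<forall>n. A n \<in> \<P>) \<longrightarrow> (\<exists>b. (\<forall>n. b n \<in> A n) \<and> range b \<in> \<Q>))"

end

theory Submission imports Defs
begin

text \<open>
  The bridge between functions and covers is the fact that Baire functions and Baire sets determine
  each other: every Baire function is measurable for the \<open>\<sigma>\<close>-algebra of Baire sets
  (\<open>baire_function_measurable\<close>), and every two-valued function that is constant on a Baire
  set and on its complement is a Baire function (\<open>two_valued_baire\<close>).

  From covers to functions: if \<open>B\<close> is 1-dense at \<open>f\<close>, then for each \<open>e > 0\<close>
  the sets \<open>{x. \<bar>h x - f x\<bar> < e}\<close> with \<open>h \<in> B\<close> are Baire sets that cover the
  space. Selecting from such covers gives functions that approximate \<open>f\<close> at every point up to the one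
  tolerance \<open>e\<close> (\<open>one_tolerance_selection\<close>). To reach all tolerances at once, the given
  sequence is split into infinitely many infinite subsequences and the tolerance
  \<open>1 / (k + 1)\<close> is served by the \<open>k\<close>-th one (\<open>interleaved_selection\<close>).

  From functions to covers: a cover \<open>\<U>\<close> is coded by the functions that are equal to a rational
  number on some \<open>U \<in> \<U>\<close> and to \<open>1\<close> off \<open>U\<close>. They form a 1-dense set, and
  a selection of them that is 1-dense at the zero function can come within \<open>1\<close> of zero at
  \<open>x\<close> only through a function whose set \<open>U\<close> contains \<open>x\<close>.

  The hub of the equivalences is the property that selects, from 1-dense sets, a set that is 1-dense
  at a given \<open>f\<close>. The other two selection properties for functions imply it because a 1-dense set is 1-dense
  at every \<open>f\<close>, and the second construction above shows that it already implies the property for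
  covers. It also implies the property for 1-dense sets: a set that is 1-dense at every rational constant
  is 1-dense, so the sequence is split once more, with one subsequence for each rational number.
\<close>

section \<open>Baire functions are Baire measurable\<close>

definition baire_algebra :: "'a topology \<Rightarrow> 'a measure" where
  "baire_algebra X = sigma (topspace X) (zero_sets X)"

lemma zero_sets_subset: "zero_sets X \<subseteq> Pow (topspace X)"
  by (auto simp: zero_sets_def)

lemma sets_baire_algebra: "sets (baire_algebra X) = baire_sets X"
  by (simp add: baire_algebra_def baire_sets_def sets_measure_of zero_sets_subset)

lemma space_baire_algebra: "space (baire_algebra X) = topspace X"
  by (simp add: baire_algebra_def space_measure_of zero_sets_subset)

lemma continuous_map_measurable:
  assumes "continuous_map X euclideanreal f"
  shows "f \<in> borel_measurable (baire_algebra X)"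
  unfolding borel_measurable_iff_le
proof
  fix a
  have "continuous_map X euclideanreal (\<lambda>x. max (f x - a) 0)"
    by (intro continuous_intros assms)
  moreover have "{x \<in> topspace X. f x \<le> a} = {x \<in> topspace X. max (f x - a) 0 = 0}"
    by auto
  ultimately have "{x \<in> topspace X. f x \<le> a} \<in> zero_sets X"
    unfolding zero_sets_def mem_Collect_eq by (intro exI conjI)
  then show "{w \<in> space (baire_algebra X). f w \<le> a} \<in> sets (baire_algebra X)"
    by (simp add: space_baire_algebra sets_baire_algebra baire_sets_def sigma_sets.Basic)
qed

lemma baire_function_measurable:
  "f \<in> baire_functions X \<Longrightarrow> f \<in> borel_measurable (baire_algebra X)"
proof (induction rule: baire_functions.induct)
  case (continuous f)
  then show ?case by (simp add: continuous_map_measurable)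
next
  case (pointwise_limit g f)
  show ?case
  proof (rule borel_measurable_LIMSEQ_real)
    show "(\<lambda>n. g n x) \<longlonglongrightarrow> f x" if "x \<in> space (baire_algebra X)" for x
      using that pointwise_limit.hyps(3) by (simp add: space_baire_algebra)
    show "g n \<in> borel_measurable (baire_algebra X)" for n
      by (rule pointwise_limit.IH)
  qed
qed

lemma baire_set_close_to:
  assumes "h \<in> baire_functions X" "f \<in> baire_functions X"
  shows "{x \<in> topspace X. \<bar>h x - f x\<bar> < e} \<in> baire_sets X"
proof -
  note [measurable] = assms[THEN baire_function_measurable]
  have "{x \<in> space (baire_algebra X). \<bar>h x - f x\<bar> < e} \<in> sets (baire_algebra X)"
    by measurable
  then show ?thesis by (simp add: space_baire_algebra sets_baire_algebra)
qed

section \<open>Two-valued functions on Baire sets are Baire functions\<close>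

text \<open>
  Baire functions are generated by transfinitely many limits, so a closure property in two arguments
  needs a nested induction: first over \<open>f\<close> with \<open>g\<close> continuous, then over \<open>g\<close> with
  \<open>f\<close> any Baire function. The limit steps hold because \<open>\<phi>\<close> is continuous.
\<close>

lemma baire_functions_compose2:
  fixes \<phi> :: "real \<times> real \<Rightarrow> real"
  assumes \<phi>: "continuous_on UNIV \<phi>"
    and f: "f \<in> baire_functions X" and g: "g \<in> baire_functions X"
  shows "restrict (\<lambda>x. \<phi> (f x, g x)) (topspace X) \<in> baire_functions X"
proof -
  have lim: "(\<lambda>n. \<phi> (u n, v n)) \<longlonglongrightarrow> \<phi> (a, b)"
    if "u \<longlonglongrightarrow> a" "v \<longlonglongrightarrow> b" for u v a b
    using continuous_on_tendsto_compose[OF \<phi> tendsto_Pair[OF that]] by simp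
  have left: "restrict (\<lambda>x. \<phi> (f x, g x)) (topspace X) \<in> baire_functions X"
    if "f \<in> baire_functions X" and g: "continuous_map X euclideanreal g" for f g
    using that(1)
  proof (induction rule: baire_functions.induct)
    case (continuous f)
    have "continuous_map X (prod_topology euclideanreal euclideanreal) (\<lambda>x. (f x, g x))"
      unfolding continuous_map_paired using continuous(2) g by blast
    then have "continuous_map X euclidean (\<lambda>x. (f x, g x))" by simp
    moreover have "continuous_map euclidean euclideanreal \<phi>" using \<phi> by simp
    ultimately have "continuous_map X euclideanreal (\<phi> \<circ> (\<lambda>x. (f x, g x)))"
      by (rule continuous_map_compose)
    then have "continuous_map X euclideanreal (\<lambda>x. \<phi> (f x, g x))" by (simp add: o_def)
    then have "continuous_map X euclideanreal (restrict (\<lambda>x. \<phi> (f x, g x)) (topspace X))"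
      by (rule continuous_map_eq) simp
    then show ?case by (rule baire_functions.continuous[OF restrict_extensional])
  next
    case (pointwise_limit h f)
    show ?case
    proof (rule baire_functions.pointwise_limit[OF pointwise_limit.IH restrict_extensional])
      fix x assume x: "x \<in> topspace X"
      have "(\<lambda>n. \<phi> (h n x, g x)) \<longlonglongrightarrow> \<phi> (f x, g x)"
        by (rule lim) (use x pointwise_limit.hyps(3) in simp_all)
      with x show "(\<lambda>n. restrict (\<lambda>x. \<phi> (h n x, g x)) (topspace X) x)
          \<longlonglongrightarrow> restrict (\<lambda>x. \<phi> (f x, g x)) (topspace X) x"
        by simp
    qed
  qed
  show ?thesis
    using g
  proof (induction rule: baire_functions.induct)
    case (continuous g)
    show ?case by (rule left[OF f continuous(2)])
  next
    case (pointwise_limit h g)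
    show ?case
    proof (rule baire_functions.pointwise_limit[OF pointwise_limit.IH restrict_extensional])
      fix x assume x: "x \<in> topspace X"
      have "(\<lambda>n. \<phi> (f x, h n x)) \<longlonglongrightarrow> \<phi> (f x, g x)"
        by (rule lim) (use x pointwise_limit.hyps(3) in simp_all)
      with x show "(\<lambda>n. restrict (\<lambda>x. \<phi> (f x, h n x)) (topspace X) x)
          \<longlonglongrightarrow> restrict (\<lambda>x. \<phi> (f x, g x)) (topspace X) x"
        by simp
    qed
  qed
qed

lemma baire_const: "restrict (\<lambda>x. c) (topspace X) \<in> baire_functions X"
proof -
  have "continuous_map X euclideanreal (restrict (\<lambda>x. c) (topspace X))"
    by (rule continuous_map_eq[of _ _ "\<lambda>x. c"]) auto
  then show ?thesis by (intro baire_functions.continuous) auto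
qed

text \<open>
  The indicator of the zero-set of \<open>g\<close> is the limit of the continuous tent functions
  \<open>max 0 (1 - n * \<bar>g x\<bar>)\<close>. Complements and finite unions correspond to \<open>1 - s\<close> and
  \<open>max s t\<close>, and a countable union is the limit of its finite partial unions.
\<close>

lemma baire_indicator:
  assumes "U \<in> baire_sets X"
  shows "restrict (indicator U) (topspace X) \<in> baire_functions X"
  using assms unfolding baire_sets_def
proof (induction rule: sigma_sets.induct)
  case (Basic U)
  then obtain g where g: "continuous_map X euclideanreal g" and U: "U = {x \<in> topspace X. g x = 0}"
    by (auto simp: zero_sets_def)
  define t where "t n = restrict (\<lambda>x. max 0 (1 - real n * \<bar>g x\<bar>)) (topspace X)" for n
  have "t n \<in> baire_functions X" for n
  proof -
    have "continuous_map X euclideanreal (\<lambda>x. max 0 (1 - real n * \<bar>g x\<bar>))"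
      by (intro continuous_intros g)
    then have "continuous_map X euclideanreal (t n)"
      by (rule continuous_map_eq) (simp add: t_def)
    then show ?thesis by (intro baire_functions.continuous) (auto simp: t_def)
  qed
  moreover have "(\<lambda>n. t n x) \<longlonglongrightarrow> restrict (indicator U) (topspace X) x"
    if x: "x \<in> topspace X" for x
  proof (cases "g x = 0")
    case True
    then show ?thesis using x by (simp add: t_def U)
  next
    case False
    then obtain N where N: "1 < real N * \<bar>g x\<bar>"
      using ex_less_of_nat_mult[of "\<bar>g x\<bar>" 1] by auto
    have "t n x = 0" if "n \<ge> N" for n
    proof -
      have "real N * \<bar>g x\<bar> \<le> real n * \<bar>g x\<bar>"
        using that by (intro mult_right_mono) auto
      then show ?thesis using N x by (simp add: t_def)
    qed
    then have "eventually (\<lambda>n. t n x = 0) sequentially"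
      by (auto simp: eventually_sequentially)
    then show ?thesis using x False by (simp add: U tendsto_eventually)
  qed
  ultimately show ?case
    by (rule baire_functions.pointwise_limit[OF _ restrict_extensional])
next
  case Empty
  have "restrict (indicator {}) (topspace X) = restrict (\<lambda>x. 0 :: real) (topspace X)"
    by (rule ext) simp
  then show ?case by (simp only: baire_const)
next
  case (Compl U)
  let ?I = "restrict (indicator U) (topspace X) :: 'a \<Rightarrow> real"
  have "restrict (\<lambda>x. (\<lambda>(s, t). 1 - s) (?I x, ?I x)) (topspace X)
      \<in> baire_functions X"
    by (rule baire_functions_compose2[OF _ Compl.IH Compl.IH])
       (auto simp: case_prod_beta intro!: continuous_intros)
  moreover have "restrict (\<lambda>x. (\<lambda>(s, t). 1 - s) (?I x, ?I x)) (topspace X)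
      = restrict (indicator (topspace X - U)) (topspace X)"
    by (rule ext) (auto simp: indicator_def)
  ultimately show ?case by (simp only:)
next
  case (Union U)
  have partial: "restrict (indicator (\<Union>i<n. U i)) (topspace X) \<in> baire_functions X" for n :: nat
  proof (induction n)
    case 0
    have "restrict (indicator (\<Union>i<0. U i)) (topspace X) = restrict (\<lambda>x. 0 :: real) (topspace X)"
      by (rule ext) simp
    then show ?case by (simp only: baire_const)
  next
    case (Suc n)
    let ?I = "restrict (indicator (\<Union>i<n. U i)) (topspace X) :: 'a \<Rightarrow> real"
    let ?J = "restrict (indicator (U n)) (topspace X) :: 'a \<Rightarrow> real"
    have "restrict (\<lambda>x. (\<lambda>(s, t). max s t) (?I x, ?J x)) (topspace X) \<in> baire_functions X"
      by (rule baire_functions_compose2[OF _ Suc.IH Union.IH])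
         (auto simp: case_prod_beta intro!: continuous_intros)
    moreover have "restrict (\<lambda>x. (\<lambda>(s, t). max s t) (?I x, ?J x)) (topspace X)
        = restrict (indicator (\<Union>i<Suc n. U i)) (topspace X)"
      by (rule ext) (auto simp: indicator_def less_Suc_eq)
    ultimately show ?case by (simp only:)
  qed
  show ?case
  proof (rule baire_functions.pointwise_limit[OF partial restrict_extensional])
    fix x assume "x \<in> topspace X"
    then show "(\<lambda>n. restrict (indicator (\<Union>i<n. U i)) (topspace X) x)
        \<longlonglongrightarrow> restrict (indicator (\<Union>i. U i) :: 'a \<Rightarrow> real) (topspace X) x"
      by (simp add: LIMSEQ_indicator_UN)
  qed
qed

lemma two_valued_baire:
  assumes "U \<in> baire_sets X"
  shows "restrict (\<lambda>x. if x \<in> U then q else r) (topspace X) \<in> baire_functions X"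
proof -
  let ?I = "restrict (indicator U) (topspace X) :: 'a \<Rightarrow> real"
  have "restrict (\<lambda>x. (\<lambda>(s, t). q * s + r * (1 - s)) (?I x, ?I x)) (topspace X) \<in> baire_functions X"
    by (rule baire_functions_compose2[OF _ baire_indicator baire_indicator])
       (use assms in \<open>auto simp: case_prod_beta intro!: continuous_intros\<close>)
  moreover have "restrict (\<lambda>x. (\<lambda>(s, t). q * s + r * (1 - s)) (?I x, ?I x)) (topspace X)
      = restrict (\<lambda>x. if x \<in> U then q else r) (topspace X)"
    by (rule ext) (auto simp: indicator_def)
  ultimately show ?thesis by (simp only:)
qed

section \<open>Selections\<close>

lemma S1D:
  fixes A :: "nat \<Rightarrow> 'b set"
  assumes "S1 \<P> \<Q>" "\<forall>n. A n \<in> \<P>"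
  shows "\<exists>b. (\<forall>n. b n \<in> A n) \<and> range b \<in> \<Q>"
  using assms unfolding S1_def by blast

lemma S1_mono:
  assumes S: "S1 \<P> \<Q>" and sub: "\<P>' \<subseteq> \<P>" "\<Q> \<subseteq> \<Q>'"
  shows "S1 \<P>' \<Q>'"
  unfolding S1_def
proof (intro allI impI)
  fix A :: "nat \<Rightarrow> 'a set"
  assume "\<forall>n. A n \<in> \<P>'"
  with sub have "\<forall>n. A n \<in> \<P>" by blast
  from S1D[OF S this] sub show "\<exists>b. (\<forall>n. b n \<in> A n) \<and> range b \<in> \<Q>'" by blast
qed

text \<open>
  If each single requirement \<open>R k\<close> can be met by a selection, then one selection meets all of
  them: the bijection between pairs and natural numbers splits the sequence into infinitely many
  subsequences, and the \<open>k\<close>-th one is used for \<open>R k\<close>.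
\<close>

lemma interleaved_selection:
  fixes A :: "nat \<Rightarrow> 'b set"
  assumes sel: "\<And>k (C :: nat \<Rightarrow> 'b set). \<forall>n. C n \<in> \<P> \<Longrightarrow>
      \<exists>c. (\<forall>n. c n \<in> C n) \<and> R k (range c)"
    and A: "\<forall>n. A n \<in> \<P>"
  shows "\<exists>b. (\<forall>n. b n \<in> A n) \<and> (\<forall>k :: nat. \<exists>T \<subseteq> range b. R k T)"
proof -
  have "\<forall>k. \<exists>c. (\<forall>m. c m \<in> A (prod_encode (k, m))) \<and> R k (range c)"
    using sel[of "\<lambda>m. A (prod_encode (_, m))"] A by blast
  then obtain c where c: "c k m \<in> A (prod_encode (k, m))" and R: "R k (range (c k))" for k m
    by metis
  define b where "b n = case_prod c (prod_decode n)" for n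
  have "b n \<in> A n" for n
    using c[of "fst (prod_decode n)" "snd (prod_decode n)"] by (simp add: b_def case_prod_beta)
  moreover have "range (c k) \<subseteq> range b" for k
  proof
    fix h assume "h \<in> range (c k)"
    then obtain m where "h = b (prod_encode (k, m))" by (auto simp: b_def)
    then show "h \<in> range b" by simp
  qed
  ultimately show ?thesis using R by blast
qed

text \<open>
  A function that is within \<open>e\<close> of \<open>f\<close> everywhere would give the member \<open>topspace X\<close>,
  which a cover must not contain. If some \<open>B m\<close> contains such a function, that function alone
  does the work; the nonemptiness of the space serves to fill the other places.
\<close>

lemma one_tolerance_selection:
  fixes B :: "nat \<Rightarrow> ('a \<Rightarrow> real) set"
  assumes S: "S1 (countable_baire_covers X) (countable_baire_covers X)"
    and ne: "topspace X \<noteq> {}" and f: "f \<in> baire_functions X"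
    and B: "\<forall>m. B m \<in> one_dense_at_family X f" and e: "e > 0"
  shows "\<exists>c. (\<forall>m. c m \<in> B m) \<and> (\<forall>x\<in>topspace X. \<exists>h\<in>range c. \<bar>h x - f x\<bar> < e)"
proof -
  define N where "N h = {x \<in> topspace X. \<bar>h x - f x\<bar> < e}" for h
  show ?thesis
  proof (cases "\<exists>m. topspace X \<in> N ` B m")
    case True
    then obtain m h where h: "h \<in> B m" "N h = topspace X" by auto
    have "B k \<noteq> {}" for k
    proof -
      obtain x where "x \<in> topspace X" using ne by blast
      moreover have "one_dense_at X f (B k)" using B by (simp add: one_dense_at_family_def)
      ultimately show ?thesis using e unfolding one_dense_at_def by blast
    qed
    then have "\<forall>k. \<exists>g. g \<in> B k" by blast
    then obtain d where "\<forall>k. d k \<in> B k" by metis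
    then have "\<forall>k. (d(m := h)) k \<in> B k" using h by simp
    moreover have "\<forall>x\<in>topspace X. \<exists>g\<in>range (d(m := h)). \<bar>g x - f x\<bar> < e"
      using h(2) unfolding N_def by (metis (mono_tags, lifting) fun_upd_same mem_Collect_eq rangeI)
    ultimately show ?thesis by blast
  next
    case False
    have "N ` B m \<in> countable_baire_covers X" for m
    proof -
      have Bm: "countable (B m)" "B m \<subseteq> baire_functions X" "one_dense_at X f (B m)"
        using B by (auto simp: one_dense_at_family_def)
      have "N ` B m \<subseteq> baire_sets X"
        using Bm(2) f by (auto simp: N_def intro: baire_set_close_to)
      moreover have "\<Union> (N ` B m) = topspace X"
        using Bm(3) e by (fastforce simp: N_def one_dense_at_def)
      ultimately show ?thesis
        using False Bm(1) by (auto simp: countable_baire_covers_def)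
    qed
    then obtain b where b: "\<And>m. b m \<in> N ` B m" and "range b \<in> countable_baire_covers X"
      using S1D[OF S, of "\<lambda>m. N ` B m"] by blast
    then have cover: "\<Union> (range b) = topspace X" by (simp add: countable_baire_covers_def)
    from b obtain c where c: "\<forall>m. c m \<in> B m \<and> b m = N (c m)" unfolding image_iff by metis
    have "\<exists>h\<in>range c. \<bar>h x - f x\<bar> < e" if "x \<in> topspace X" for x
    proof -
      from that cover obtain m where "x \<in> b m" by blast
      with c have "x \<in> N (c m)" by simp
      then show ?thesis unfolding N_def by blast
    qed
    then show ?thesis using c by blast
  qed
qed

text \<open>
  On the empty space the empty family is a cover from which nothing can be selected, so the selection
  property itself forces the space to be nonempty.
\<close>

lemma S1_covers_nonempty:
  assumes "S1 (countable_baire_covers X) (countable_baire_covers X)"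
  shows "topspace X \<noteq> {}"
proof
  assume "topspace X = {}"
  then have "{} \<in> countable_baire_covers X" by (simp add: countable_baire_covers_def)
  then show False using S1D[OF assms, of "\<lambda>_. {}"] by simp
qed

section \<open>The implications\<close>

lemma one_dense_imp_one_dense_at: "one_dense X A \<Longrightarrow> one_dense_at X f A"
  unfolding one_dense_def one_dense_at_def
proof (intro ballI allI impI)
  fix x and e :: real
  assume A: "\<forall>x\<in>topspace X. \<forall>W. open W \<and> W \<noteq> {} \<longrightarrow> (\<exists>g\<in>A. g x \<in> W)"
    and x: "x \<in> topspace X" and "e > 0"
  then have "open (ball (f x) e) \<and> ball (f x) e \<noteq> {}" by simp
  with A x have "\<exists>g\<in>A. g x \<in> ball (f x) e" by blast
  then show "\<exists>h\<in>A. \<bar>h x - f x\<bar> < e" by (auto simp: dist_real_def abs_minus_commute)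
qed

lemma one_dense_family_subset: "one_dense_family X \<subseteq> one_dense_at_family X f"
  by (auto simp: one_dense_family_def one_dense_at_family_def one_dense_imp_one_dense_at)

text \<open>
  Countably many constants suffice because the rational numbers meet every nonempty open set of reals;
  countability is what lets one sequence of choices serve all of them.
\<close>

lemma one_dense_if_one_dense_at_rationals:
  assumes "\<And>q. q \<in> \<rat> \<Longrightarrow> one_dense_at X (restrict (\<lambda>x. q) (topspace X)) A"
  shows "one_dense X A"
  unfolding one_dense_def
proof (intro ballI allI impI)
  fix x and W :: "real set"
  assume x: "x \<in> topspace X" and W: "open W \<and> W \<noteq> {}"
  then obtain a e where a: "e > 0" "ball a e \<subseteq> W" by (metis ex_in_conv openE)
  obtain q where q: "q \<in> \<rat>" "a < q" "q < a + e"
    using Rats_dense_in_real[of a "a + e"] a by auto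
  then have "q \<in> W" using a by (auto simp: dist_real_def subset_iff)
  then obtain d where d: "d > 0" "ball q d \<subseteq> W" using W by (metis openE)
  obtain h where "h \<in> A" "\<bar>h x - q\<bar> < d"
    using assms[OF q(1)] x d(1) by (auto simp: one_dense_at_def)
  then show "\<exists>g\<in>A. g x \<in> W" using d(2) by (force simp: dist_real_def abs_minus_commute)
qed

lemma covers_imp_dense_at:
  assumes S: "S1 (countable_baire_covers X) (countable_baire_covers X)"
    and f: "f \<in> baire_functions X"
  shows "S1 (one_dense_at_family X f) (one_dense_at_family X f)"
  unfolding S1_def
proof (intro allI impI)
  fix A :: "nat \<Rightarrow> ('a \<Rightarrow> real) set"
  assume A: "\<forall>n. A n \<in> one_dense_at_family X f"
  have "\<exists>b. (\<forall>n. b n \<in> A n) \<and> (\<forall>k. \<exists>T \<subseteq> range b.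
      \<forall>x\<in>topspace X. \<exists>h\<in>T. \<bar>h x - f x\<bar> < inverse (real (Suc k)))"
    by (rule interleaved_selection[OF _ A],
        rule one_tolerance_selection[OF S S1_covers_nonempty[OF S] f]) auto
  then obtain b where b: "\<forall>n. b n \<in> A n"
    and close: "\<And>k. \<exists>T \<subseteq> range b. \<forall>x\<in>topspace X. \<exists>h\<in>T. \<bar>h x - f x\<bar> < inverse (real (Suc k))"
    by blast
  have "one_dense_at X f (range b)"
    unfolding one_dense_at_def
  proof (intro ballI allI impI)
    fix x and e :: real
    assume x: "x \<in> topspace X" and "e > 0"
    then obtain k where k: "inverse (real (Suc k)) < e" using reals_Archimedean by blast
    from close[of k] x obtain h where "h \<in> range b" "\<bar>h x - f x\<bar> < inverse (real (Suc k))" by blast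
    with k show "\<exists>h\<in>range b. \<bar>h x - f x\<bar> < e" by (meson less_trans)
  qed
  moreover have "range b \<subseteq> baire_functions X"
    using b A by (auto simp: one_dense_at_family_def)
  ultimately show "\<exists>b. (\<forall>n. b n \<in> A n) \<and> range b \<in> one_dense_at_family X f"
    using b by (auto simp: one_dense_at_family_def intro!: exI[of _ b])
qed

lemma dense_at_all_imp_dense:
  assumes S: "\<And>f. f \<in> baire_functions X \<Longrightarrow> S1 (one_dense_family X) (one_dense_at_family X f)"
  shows "S1 (one_dense_family X) (one_dense_family X)"
  unfolding S1_def
proof (intro allI impI)
  fix A :: "nat \<Rightarrow> ('a \<Rightarrow> real) set"
  assume A: "\<forall>n. A n \<in> one_dense_family X"
  \<comment> \<open>the \<open>k\<close>-th subsequence serves the \<open>k\<close>-th rational constant\<close>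
  define q where "q k = restrict (\<lambda>x. from_nat_into \<rat> k :: real) (topspace X)" for k
  have "\<exists>b. (\<forall>n. b n \<in> A n) \<and> (\<forall>k. \<exists>T \<subseteq> range b. T \<in> one_dense_at_family X (q k))"
    by (rule interleaved_selection[OF _ A])
       (use S[OF baire_const] in \<open>simp add: S1_def q_def\<close>)
  then obtain b where b: "\<forall>n. b n \<in> A n"
    and T: "\<And>k. \<exists>T \<subseteq> range b. T \<in> one_dense_at_family X (q k)" by blast
  have dense: "one_dense_at X (q k) (range b)" for k
  proof -
    obtain T where "T \<subseteq> range b" "one_dense_at X (q k) T"
      using T[of k] by (auto simp: one_dense_at_family_def)
    then show ?thesis unfolding one_dense_at_def by blast
  qed
  have "one_dense X (range b)"
  proof (rule one_dense_if_one_dense_at_rationals)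
    fix r :: real assume "r \<in> \<rat>"
    then obtain k where "r = from_nat_into \<rat> k"
      using from_nat_into_surj[OF countable_rat] by metis
    then show "one_dense_at X (restrict (\<lambda>x. r) (topspace X)) (range b)"
      using dense[of k] by (simp add: q_def)
  qed
  moreover have "range b \<subseteq> baire_functions X"
    using b A by (auto simp: one_dense_family_def)
  ultimately show "\<exists>b. (\<forall>n. b n \<in> A n) \<and> range b \<in> one_dense_family X"
    using b by (auto simp: one_dense_family_def intro!: exI[of _ b])
qed

text \<open>
  The value \<open>1\<close> off \<open>U\<close> makes the function useless for approximating zero there with tolerance
  \<open>1\<close>. On \<open>U\<close> all rational values are allowed, since the coding set has to be 1-dense and not
  only 1-dense at zero.
\<close>

lemma dense_at_zero_imp_covers:
  assumes S: "S1 (one_dense_family X) (one_dense_at_family X (restrict (\<lambda>x. 0) (topspace X)))"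
  shows "S1 (countable_baire_covers X) (countable_baire_covers X)"
  unfolding S1_def
proof (intro allI impI)
  fix \<U> :: "nat \<Rightarrow> 'a set set"
  assume U: "\<forall>n. \<U> n \<in> countable_baire_covers X"
  define F where "F U r = restrict (\<lambda>x. if x \<in> U then r else (1::real)) (topspace X)" for U r
  define A where "A n = case_prod F ` (\<U> n \<times> \<rat>)" for n
  have "A n \<in> one_dense_family X" for n
  proof -
    have Un: "countable (\<U> n)" "\<U> n \<subseteq> baire_sets X" "\<Union> (\<U> n) = topspace X"
      using U by (auto simp: countable_baire_covers_def)
    have "countable (A n)" using Un(1) countable_rat by (auto simp: A_def)
    moreover have "A n \<subseteq> baire_functions X"
      using Un(2) by (auto simp: A_def F_def intro!: two_valued_baire)
    moreover have "one_dense X (A n)"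
      unfolding one_dense_def
    proof (intro ballI allI impI)
      fix x and W :: "real set"
      assume x: "x \<in> topspace X" and W: "open W \<and> W \<noteq> {}"
      then obtain a e where a: "e > 0" "ball a e \<subseteq> W" by (metis ex_in_conv openE)
      obtain r where r: "r \<in> \<rat>" "a < r" "r < a + e"
        using Rats_dense_in_real[of a "a + e"] a by auto
      then have "r \<in> W" using a by (auto simp: dist_real_def subset_iff)
      moreover obtain V where V: "V \<in> \<U> n" "x \<in> V" using x Un(3) by blast
      ultimately have "F V r x \<in> W" using x by (simp add: F_def)
      moreover have "F V r \<in> A n"
        unfolding A_def using V r by (intro image_eqI[of _ _ "(V, r)"]) auto
      ultimately show "\<exists>g\<in>A n. g x \<in> W" by blast
    qed
    ultimately show ?thesis by (simp add: one_dense_family_def)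
  qed
  then obtain b where b: "\<And>n. b n \<in> A n"
    and "range b \<in> one_dense_at_family X (restrict (\<lambda>x. 0) (topspace X))"
    using S1D[OF S, of A] by blast
  then have dense: "one_dense_at X (restrict (\<lambda>x. 0) (topspace X)) (range b)"
    by (simp add: one_dense_at_family_def)
  have "\<forall>n. \<exists>V r. V \<in> \<U> n \<and> b n = F V r"
    using b by (fastforce simp: A_def)
  then obtain V r where V: "\<And>n. V n \<in> \<U> n" and bV: "\<And>n. b n = F (V n) (r n)" by metis
  have Vn: "V n \<in> baire_sets X" "V n \<noteq> topspace X" "V n \<subseteq> topspace X" for n
    using U V[of n] by (auto simp: countable_baire_covers_def)
  have "x \<in> \<Union> (range V)" if x: "x \<in> topspace X" for x
  proof -
    obtain n where "\<bar>b n x - 0\<bar> < 1"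
      using dense x zero_less_one unfolding one_dense_at_def by fastforce
    then have "x \<in> V n" using x by (auto simp: bV F_def split: if_splits)
    then show ?thesis by blast
  qed
  then have "\<Union> (range V) = topspace X" using Vn(3) by blast
  moreover have "range V \<subseteq> baire_sets X" using Vn(1) by blast
  moreover have "topspace X \<notin> range V" using Vn(2) by (metis imageE)
  ultimately have "range V \<in> countable_baire_covers X"
    by (simp add: countable_baire_covers_def)
  then show "\<exists>V. (\<forall>n. V n \<in> \<U> n) \<and> range V \<in> countable_baire_covers X"
    using V by blast
qed

theorem theorem8p3:
  fixes X :: "'a topology"
  assumes "tychonoff_space X"
  shows "(S1 (one_dense_family X) (one_dense_family X)
            \<longleftrightarrow> S1 (countable_baire_covers X) (countable_baire_covers X)) \<and>
         (S1 (countable_baire_covers X) (countable_baire_covers X)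
            \<longleftrightarrow> (\<forall>f\<in>baire_functions X. S1 (one_dense_at_family X f) (one_dense_at_family X f))) \<and>
         ((\<forall>f\<in>baire_functions X. S1 (one_dense_at_family X f) (one_dense_at_family X f))
            \<longleftrightarrow> (\<forall>f\<in>baire_functions X. S1 (one_dense_family X) (one_dense_at_family X f)))"
proof -
  let ?s1 = "S1 (one_dense_family X) (one_dense_family X)"
  let ?s2 = "S1 (countable_baire_covers X) (countable_baire_covers X)"
  let ?s3 = "\<forall>f\<in>baire_functions X. S1 (one_dense_at_family X f) (one_dense_at_family X f)"
  let ?s4 = "\<forall>f\<in>baire_functions X. S1 (one_dense_family X) (one_dense_at_family X f)"
  have "?s1 \<Longrightarrow> ?s4"
    by (intro ballI S1_mono[OF _ subset_refl one_dense_family_subset])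
  moreover have "?s4 \<Longrightarrow> ?s1"
    by (rule dense_at_all_imp_dense) (erule bspec)
  moreover have "?s4 \<Longrightarrow> ?s2"
    by (rule dense_at_zero_imp_covers) (erule bspec[OF _ baire_const])
  moreover have "?s2 \<Longrightarrow> ?s3"
    by (intro ballI covers_imp_dense_at)
  moreover have "?s3 \<Longrightarrow> ?s4"
    by (intro ballI S1_mono[OF _ one_dense_family_subset subset_refl]) (erule bspec)
  ultimately show ?thesis by blast
qed

end
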